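(* Assume that $N\to\infty$, $n\to\infty$, $p=n/N\to 0$ and $M\to\infty$, $m\to\infty$, $q=m/M\to 0$, and let $a=a_{n,m,N,M}>0$. Put $$A_1 = \frac{a \sqrt{m}}{ \sqrt{2}\, (\sqrt{\log(n)}+\sqrt{\log(N-n)}) },\qquad A_2 = \frac{a \sqrt{n}}{ \sqrt{2}\, (\sqrt{\log(m)}+\sqrt{\log(M-m)})}.$$ Let $\hat C^\star$ be the selector $\hat C^\star(Y)=\arg\max_{C\in\mathcal{C}_{nm}}\sum_{(i,j)\in C}Y_{ij}$. If $$\limsup A_1<1\quad\text{or}\quad \limsup A_2<1,$$ then, for any $C_0$ such that $S_{C_0}\in\mathcal{S}_{nm,a}$, $$P_{C_0}(\hat C^\star\neq C_0)\longrightarrow 1 .$$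
   Context: Model: one observes an $N\times M$ random matrix $Y=\{Y_{ij}\}$, $Y_{ij}=s_{ij}+\xi_{ij}$, $i=1,\dots,N$, $j=1,\dots,M$, where the $\xi_{ij}$ are i.i.d. standard Gaussian $\mathcal{N}(0,1)$ random variables and $s_{ij}\in\mathbb{R}$. $\mathcal{C}_{nm}$ is the collection of all sets $C=A\times B\subset\{1,\dots,N\}\times\{1,\dots,M\}$ with $\mathrm{Card}(A)=n$ and $\mathrm{Card}(B)=m$. For $a>0$ (which may depend on $n,m,N,M$), $\mathcal{S}_{nm,a}$ is the collection of all matrices $S=S_C=\{s_{ij}\}$, $C\in\mathcal{C}_{nm}$, such that $s_{ij}=0$ if $(i,j)\notin C$ and $s_{ij}\ge a$ if $(i,j)\in C$. $P_{C_0}$ denotes the probability measure corresponding to the observations $Y$ when the mean matrix is $S_{C_0}=\{s_{ij}\}$, with $s_{ij}=0$ for $(i,j)\notin C_0$ and $s_{ij}\ge a>0$ for $(i,j)\in C_0$. A selector is any measurable function of the observations taking values in $\mathcal{C}_{nm}$. Asymptotics: $n=n_{NM}$, $m=m_{NM}$ and $a$ may depend on $N,M$; all limits and $\limsup$ are taken as $N,M\to\infty$.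
   Formalization: The claim fails for some S_{C_0} with s_ij much larger than a on C_0; it is stated instead, for any C_0, for the matrix with s_ij = a on C_0 and for the supremum of the error probability over all matrices with s_ij ≥ a on C_0. *)

theory Defs
  imports "HOL-Probability.Probability"
begin

definition index_set :: "nat \<Rightarrow> nat \<Rightarrow> (nat \<times> nat) set" where
  "index_set N M = {1..N} \<times> {1..M}"

definition submatrix_sets :: "nat \<Rightarrow> nat \<Rightarrow> nat \<Rightarrow> nat \<Rightarrow> (nat \<times> nat) set set" where
  "submatrix_sets N M n m =
     {A \<times> B |A B. A \<subseteq> {1..N} \<and> B \<subseteq> {1..M} \<and> card A = n \<and> card B = m}"

text \<open>Matrices are functions on pairs of indices; only their values on
  \<^term>\<open>index_set N M\<close> matter. The set below consists of the mean matrices \<open>S\<^sub>C\<close>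
  attached to a given \<open>C\<close>; the class of all admissible mean matrices is its union over \<open>C\<close> in
  \<^term>\<open>submatrix_sets N M n m\<close>.\<close>

definition signals_on ::
    "nat \<Rightarrow> nat \<Rightarrow> (nat \<times> nat) set \<Rightarrow> real \<Rightarrow> (nat \<times> nat \<Rightarrow> real) set" where
  "signals_on N M C a =
     {s. (\<forall>ij \<in> index_set N M - C. s ij = 0) \<and> (\<forall>ij \<in> C. s ij \<ge> a)}"

text \<open>The element of \<^term>\<open>signals_on N M C a\<close> with the weakest signal.\<close>

definition flat_signal :: "(nat \<times> nat) set \<Rightarrow> real \<Rightarrow> nat \<times> nat \<Rightarrow> real" where
  "flat_signal C a = (\<lambda>ij. if ij \<in> C then a else 0)"

abbreviation matrix_space :: "nat \<Rightarrow> nat \<Rightarrow> (nat \<times> nat \<Rightarrow> real) measure" where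
  "matrix_space N M \<equiv> \<Pi>\<^sub>M ij \<in> index_set N M. borel"

definition noise_law :: "nat \<Rightarrow> nat \<Rightarrow> (nat \<times> nat \<Rightarrow> real) measure" where
  "noise_law N M = (\<Pi>\<^sub>M ij \<in> index_set N M. density lborel (\<lambda>x. ennreal (std_normal_density x)))"

text \<open>The law of \<open>Y = s + \<xi>\<close>, where \<open>\<xi>\<close> has i.i.d. standard Gaussian entries.\<close>

definition obs_law :: "nat \<Rightarrow> nat \<Rightarrow> (nat \<times> nat \<Rightarrow> real) \<Rightarrow> (nat \<times> nat \<Rightarrow> real) measure" where
  "obs_law N M s =
     distr (noise_law N M) (matrix_space N M) (\<lambda>\<xi>. \<lambda>ij \<in> index_set N M. s ij + \<xi> ij)"

type_synonym estimator = "(nat \<times> nat \<Rightarrow> real) \<Rightarrow> (nat \<times> nat) set"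

definition selector :: "nat \<Rightarrow> nat \<Rightarrow> nat \<Rightarrow> nat \<Rightarrow> estimator \<Rightarrow> bool" where
  "selector N M n m D \<longleftrightarrow> D \<in> matrix_space N M \<rightarrow>\<^sub>M count_space (submatrix_sets N M n m)"

text \<open>The maximiser is almost surely unique; on the null event of ties, any measurable
  choice among the maximisers is admitted.\<close>

definition argmax_selector :: "nat \<Rightarrow> nat \<Rightarrow> nat \<Rightarrow> nat \<Rightarrow> estimator \<Rightarrow> bool" where
  "argmax_selector N M n m D \<longleftrightarrow>
     selector N M n m D \<and>
     (\<forall>Y \<in> space (matrix_space N M).
        is_arg_max (\<lambda>C. \<Sum>ij\<in>C. Y ij) (\<lambda>C. C \<in> submatrix_sets N M n m) (D Y))"

definition error_prob ::
    "nat \<Rightarrow> nat \<Rightarrow> (nat \<times> nat \<Rightarrow> real) \<Rightarrow> estimator \<Rightarrow> (nat \<times> nat) set \<Rightarrow> real" where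
  "error_prob N M s D C = \<P>(Y in obs_law N M s. D Y \<noteq> C)"

text \<open>The infimum of the error probability over the whole class is not bounded away from 0
  below the threshold: if all \<open>s\<^sub>i\<^sub>j\<close> on \<open>C\<close> are huge compared with \<open>a\<close>, then \<open>C\<close> is recovered.
  The meaningful quantity for given \<open>C\<close> is the worst case over the mean matrices supported by \<open>C\<close>.\<close>

definition worst_error_prob ::
    "nat \<Rightarrow> nat \<Rightarrow> real \<Rightarrow> estimator \<Rightarrow> (nat \<times> nat) set \<Rightarrow> real" where
  "worst_error_prob N M a D C = (SUP s \<in> signals_on N M C a. error_prob N M s D C)"

definition A1 :: "nat \<Rightarrow> nat \<Rightarrow> nat \<Rightarrow> nat \<Rightarrow> real \<Rightarrow> real" where
  "A1 N M n m a =
     a * sqrt (real m) / (sqrt 2 * (sqrt (ln (real n)) + sqrt (ln (real N - real n))))"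

definition A2 :: "nat \<Rightarrow> nat \<Rightarrow> nat \<Rightarrow> nat \<Rightarrow> real \<Rightarrow> real" where
  "A2 N M n m a =
     a * sqrt (real n) / (sqrt 2 * (sqrt (ln (real m)) + sqrt (ln (real M - real m))))"

end

theory Submission
  imports Defs "HOL-Real_Asymp.Real_Asymp"
begin

text \<open>The maximiser can equal \<open>C\<^sub>0 = A \<times> B\<close> only if no single exchange of a row of \<open>A\<close> for a row
  outside \<open>A\<close> increases the sum (lemma \<open>argmax_row_exchange\<close>). Under the flat signal, with all means on
  \<open>C\<^sub>0\<close> equal to \<open>a\<close>, let \<open>Z\<^sub>i\<close> be the noise summed over \<open>{i} \<times> B\<close> and divided by \<open>\<surd>m\<close>; the \<open>Z\<^sub>i\<close> are
  i.i.d. standard normal, and the absence of a profitable exchange reads \<open>Z\<^sub>k - Z\<^sub>i \<le> a \<surd>m\<close> for all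
  \<open>i \<in> A\<close>, \<open>k \<notin> A\<close>. Yet the minimum of \<open>n\<close> such variables is about \<open>-\<surd>(2 ln n)\<close> and the maximum of
  \<open>N - n\<close> of them about \<open>\<surd>(2 ln (N - n))\<close>. The assumption \<open>limsup A\<^sub>1 < 1\<close> provides a \<open>c < 1\<close> with
  \<open>a \<surd>m \<le> t\<^sub>1 + t\<^sub>2\<close> eventually, where \<open>t\<^sub>1 = c \<surd>(2 ln n)\<close> and \<open>t\<^sub>2 = c \<surd>(2 ln (N - n))\<close>. Recovery then
  forces all \<open>Z\<^sub>i\<close>, \<open>i \<in> A\<close>, to be at least \<open>-t\<^sub>1\<close>, or all \<open>Z\<^sub>k\<close>, \<open>k \<notin> A\<close>, to be at most \<open>t\<^sub>2\<close>
  (lemma \<open>prob_range_le\<close>).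

  Both events are unlikely: among \<open>x\<close> independent standard normal variables, none exceeds \<open>t \<ge> 0\<close> with
  probability at most \<open>(1 - \<phi>(t + 1))\<^sup>x \<le> exp (- x \<phi>(t + 1))\<close>, where \<open>\<phi>\<close> is the standard normal
  density. For \<open>t = c \<surd>(2 ln x)\<close> the product \<open>x \<phi>(t + 1)\<close> is \<open>x\<close> to the power \<open>1 - c\<^sup>2 > 0\<close>, up to factors
  of smaller order, so the bound tends to 0 (lemma \<open>miss_bound_tendsto_0\<close>).

  Columns play the same role for \<open>A\<^sub>2\<close>. Both cases are instances of a comparison of disjoint blocks of
  entries of equal size, some inside \<open>C\<^sub>0\<close> and some outside (lemma \<open>recovery_prob_le_blocks\<close>). The flat
  signal is one of the admissible mean matrices, so the worst error probability lies between its error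
  probability and 1.\<close>

section \<open>Extremes of independent standard normal variables\<close>

abbreviation std_normal :: "real measure" where
  "std_normal \<equiv> density lborel (\<lambda>x. ennreal (std_normal_density x))"

lemma prob_space_std_normal: "prob_space std_normal"
  by (rule prob_space_normal_density) simp

text \<open>The density decreases on the nonnegative half-line, so its integral over the unit interval
  above \<open>t\<close> is at least its value at the right end. The factor lost against the true tail is
  negligible on the scale used here.\<close>

lemma std_normal_tail_lower:
  assumes "0 \<le> t"
  shows "measure std_normal {t<..} \<ge> std_normal_density (t + 1)"
proof -
  interpret prob_space std_normal by (rule prob_space_std_normal)
  have "ennreal (std_normal_density (t + 1))
      = (\<integral>\<^sup>+x. ennreal (std_normal_density (t + 1)) * indicator {t<..t+1} x \<partial>lborel)"
    by (subst nn_integral_cmult_indicator) auto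
  also have "\<dots> \<le> (\<integral>\<^sup>+x. ennreal (std_normal_density x) * indicator {t<..} x \<partial>lborel)"
  proof (rule nn_integral_mono)
    fix x :: real
    show "ennreal (std_normal_density (t + 1)) * indicator {t<..t+1} x
        \<le> ennreal (std_normal_density x) * indicator {t<..} x"
    proof (cases "x \<in> {t<..t+1}")
      case True
      then have "x\<^sup>2 \<le> (t + 1)\<^sup>2"
        using assms by (intro power_mono) auto
      then have "std_normal_density (t + 1) \<le> std_normal_density x"
        by (auto simp: std_normal_density_def divide_right_mono)
      with True show ?thesis by (auto intro!: ennreal_leI)
    qed auto
  qed
  also have "\<dots> = emeasure std_normal {t<..}"
    by (subst emeasure_density) auto
  finally show ?thesis
    by (simp add: emeasure_eq_measure)
qed

lemma measure_std_normal_minus: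
  assumes "A \<in> sets borel"
  shows "measure std_normal (uminus -` A) = measure std_normal A"
proof -
  interpret prob_space std_normal by (rule prob_space_std_normal)
  have "distributed std_normal lborel (\<lambda>x. x) (normal_density 0 1)"
    by (auto simp: distributed_def distr_id2)
  from normal_density_affine[OF this, of "-1" 0]
  have "distr std_normal lborel uminus = std_normal"
    by (auto dest: distributed_distr_eq_density)
  then have "measure std_normal A = measure (distr std_normal lborel uminus) A" by simp
  also have "\<dots> = measure std_normal (uminus -` A)"
    using assms by (subst measure_distr) (auto simp: space_density)
  finally show ?thesis by simp
qed

text \<open>By independence the probability is a power of \<open>1 - P(A) \<le> exp (- p)\<close>.\<close>

lemma (in prob_space) prob_all_miss_le:
  fixes Z :: "'k \<Rightarrow> 'a \<Rightarrow> real"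
  assumes Z: "indep_vars (\<lambda>_. borel) Z K" and K: "finite K"
    and law: "\<And>k. k \<in> K \<Longrightarrow> distr M borel (Z k) = std_normal"
    and A: "A \<in> sets borel" and p: "p \<le> measure std_normal A"
  shows "prob {x \<in> space M. \<forall>k\<in>K. Z k x \<notin> A} \<le> exp (- (real (card K) * p))"
proof (cases "K = {}")
  case True
  then show ?thesis by simp
next
  case False
  interpret G: prob_space std_normal by (rule prob_space_std_normal)
  have rv: "random_variable borel (Z k)" if "k \<in> K" for k
    using Z that by (auto simp: indep_vars_def)
  have each: "prob (Z k -` (- A) \<inter> space M) \<le> exp (- p)" if "k \<in> K" for k
  proof -
    have "prob (Z k -` (- A) \<inter> space M) = measure (distr M borel (Z k)) (- A)"
      using rv[OF that] A by (subst measure_distr) auto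
    also have "\<dots> = 1 - measure std_normal A"
      using A G.prob_compl[of A] by (simp add: law[OF that] Compl_eq_Diff_UNIV)
    also have "\<dots> \<le> exp (- p)"
      using p exp_ge_add_one_self[of "- p"] by simp
    finally show ?thesis .
  qed
  have "{x \<in> space M. \<forall>k\<in>K. Z k x \<notin> A} = (\<Inter>k\<in>K. Z k -` (- A) \<inter> space M)"
    using False by auto
  also have "prob \<dots> = (\<Prod>k\<in>K. prob (Z k -` (- A) \<inter> space M))"
    using A False K by (intro indep_varsD[OF Z]) auto
  also have "\<dots> \<le> (\<Prod>k\<in>K. exp (- p))"
    using each by (intro prod_mono) auto
  also have "\<dots> = exp (- (real (card K) * p))"
    by (simp add: exp_of_nat_mult[symmetric])
  finally show ?thesis .
qed

text \<open>If some \<open>Z\<^sub>i\<close> with \<open>i \<in> I\<close> were below \<open>-t\<^sub>1\<close> and some \<open>Z\<^sub>k\<close> with \<open>k \<in> J\<close> above \<open>t\<^sub>2\<close>, their difference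
  would exceed \<open>t\<^sub>1 + t\<^sub>2\<close>. Hence on \<open>E\<close> one of the two extremes fails to occur. Bounding the
  probability of an arbitrary subset \<open>E\<close> lets the lemma apply directly to the event of correct
  recovery.\<close>

lemma (in prob_space) prob_range_le:
  fixes Z :: "'k \<Rightarrow> 'a \<Rightarrow> real"
  assumes Z: "indep_vars (\<lambda>_. borel) Z K" and K: "finite K"
    and law: "\<And>k. k \<in> K \<Longrightarrow> distr M borel (Z k) = std_normal"
    and I: "I \<subseteq> K" and J: "J \<subseteq> K" and t: "0 \<le> t\<^sub>1" "0 \<le> t\<^sub>2"
    and E: "E \<subseteq> {x \<in> space M. \<forall>i\<in>I. \<forall>k\<in>J. Z k x - Z i x \<le> t\<^sub>1 + t\<^sub>2}"
  shows "prob E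
    \<le> exp (- (real (card I) * std_normal_density (t\<^sub>1 + 1)))
      + exp (- (real (card J) * std_normal_density (t\<^sub>2 + 1)))"
proof -
  have fin: "finite I" "finite J"
    using K I J by (auto intro: finite_subset)
  have rv[measurable]: "random_variable borel (Z k)" if "k \<in> K" for k
    using Z that by (auto simp: indep_vars_def)
  \<comment> \<open>The lower extreme is the upper extreme of the variables \<open>- Z\<^sub>i\<close>, hence the reflected half-line.\<close>
  define lo where "lo = {x \<in> space M. \<forall>i\<in>I. Z i x \<notin> uminus -` {t\<^sub>1<..}}"
  define hi where "hi = {x \<in> space M. \<forall>k\<in>J. Z k x \<notin> {t\<^sub>2<..}}"
  have "lo \<in> events"
    unfolding lo_def using fin I by (intro sets.sets_Collect_finite_All) (auto intro!: rv simp: subset_iff)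
  have "hi \<in> events"
    unfolding hi_def using fin J by (intro sets.sets_Collect_finite_All) (auto intro!: rv simp: subset_iff)
  have uv: "uminus -` {t\<^sub>1<..} \<in> sets borel"
    by (intro measurable_sets_borel[where M = borel]) auto
  have "prob E \<le> prob (lo \<union> hi)"
  proof (rule finite_measure_mono)
    show "E \<subseteq> lo \<union> hi"
      using E unfolding lo_def hi_def by fastforce
  qed (use \<open>lo \<in> events\<close> \<open>hi \<in> events\<close> in auto)
  also have "\<dots> \<le> prob lo + prob hi"
    using \<open>lo \<in> events\<close> \<open>hi \<in> events\<close> by (rule measure_Un_le)
  also have "prob lo \<le> exp (- (real (card I) * std_normal_density (t\<^sub>1 + 1)))"
    unfolding lo_def using I fin std_normal_tail_lower[OF t(1)] uv
    by (intro prob_all_miss_le indep_vars_subset[OF Z]) (auto simp: law measure_std_normal_minus)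
  also have "prob hi \<le> exp (- (real (card J) * std_normal_density (t\<^sub>2 + 1)))"
    unfolding hi_def using J fin std_normal_tail_lower[OF t(2)]
    by (intro prob_all_miss_le indep_vars_subset[OF Z]) (auto simp: law)
  finally show ?thesis by simp
qed

section \<open>Sums of Gaussian noise over disjoint blocks\<close>

lemma indep_vars_PiM_std_normal:
  assumes "finite T"
  shows "prob_space.indep_vars (\<Pi>\<^sub>M j\<in>T. std_normal) (\<lambda>_. borel) (\<lambda>j \<xi>. \<xi> j) T"
proof (cases "T = {}")
  case True
  interpret P: prob_space "\<Pi>\<^sub>M j\<in>T. std_normal"
    by (intro prob_space_PiM prob_space_std_normal)
  show ?thesis unfolding P.indep_vars_def P.indep_sets_def using True by auto
next
  case False
  interpret P: prob_space "\<Pi>\<^sub>M j\<in>T. std_normal"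
    by (intro prob_space_PiM prob_space_std_normal)
  have comp: "distr (\<Pi>\<^sub>M j\<in>T. std_normal) borel (\<lambda>\<xi>. \<xi> j) = std_normal" if "j \<in> T" for j
    using distr_PiM_component[of T "\<lambda>_. std_normal" j] that prob_space_std_normal
    by (simp cong: distr_cong)
  have "distr (\<Pi>\<^sub>M j\<in>T. std_normal) (\<Pi>\<^sub>M j\<in>T. borel) (\<lambda>\<xi>. \<lambda>j\<in>T. \<xi> j)
      = distr (\<Pi>\<^sub>M j\<in>T. std_normal) (\<Pi>\<^sub>M j\<in>T. std_normal) (\<lambda>\<xi>. \<xi>)"
    by (intro distr_cong sets_PiM_cong) (auto simp: space_PiM fun_eq_iff PiE_def extensional_def)
  also have "\<dots> = (\<Pi>\<^sub>M j\<in>T. distr (\<Pi>\<^sub>M j\<in>T. std_normal) borel (\<lambda>\<xi>. \<xi> j))"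
    by (simp add: comp cong: PiM_cong)
  finally show ?thesis
    using False by (subst P.indep_vars_iff_distr_eq_PiM') (auto intro!: measurable_component_singleton)
qed

lemma block_sums_std_normal:
  fixes L :: "'k \<Rightarrow> 'j set"
  defines "Z \<equiv> \<lambda>m k \<xi>. (\<Sum>j\<in>L k. \<xi> j :: real) / sqrt (real m)"
  assumes T: "finite T" and L: "\<And>k. k \<in> K \<Longrightarrow> L k \<subseteq> T" and disj: "disjoint_family_on L K"
    and card: "\<And>k. k \<in> K \<Longrightarrow> card (L k) = m" and m: "0 < m"
  shows "prob_space.indep_vars (\<Pi>\<^sub>M j\<in>T. std_normal) (\<lambda>_. borel) (Z m) K"
    and "k \<in> K \<Longrightarrow> distr (\<Pi>\<^sub>M j\<in>T. std_normal) borel (Z m k) = std_normal"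
proof -
  interpret P: prob_space "\<Pi>\<^sub>M j\<in>T. std_normal"
    by (intro prob_space_PiM prob_space_std_normal)
  note ind = indep_vars_PiM_std_normal[OF T]
  have "P.indep_vars (\<lambda>_. borel) (\<lambda>k \<xi>. (\<lambda>y. (\<Sum>j\<in>L k. y j) / sqrt (real m)) (restrict (\<lambda>j. \<xi> j) (L k))) K"
    by (rule P.indep_vars_compose2[OF P.indep_vars_restrict[OF ind L disj]]) auto
  then show "P.indep_vars (\<lambda>_. borel) (Z m) K"
    by (simp add: Z_def)
  assume k: "k \<in> K"
  have ne: "finite (L k)" "L k \<noteq> {}"
    using card[OF k] m by (auto intro: card_ge_0_finite)
  have comp: "distributed (\<Pi>\<^sub>M j\<in>T. std_normal) lborel (\<lambda>\<xi>. \<xi> j) (normal_density 0 1)"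
    if "j \<in> T" for j
  proof -
    have "distr (\<Pi>\<^sub>M j\<in>T. std_normal) lborel (\<lambda>\<xi>. \<xi> j)
        = distr (\<Pi>\<^sub>M j\<in>T. std_normal) std_normal (\<lambda>\<xi>. \<xi> j)"
      by (rule distr_cong) auto
    also have "\<dots> = std_normal"
      using distr_PiM_component[of T "\<lambda>_. std_normal" j] that prob_space_std_normal by simp
    finally have "distr (\<Pi>\<^sub>M j\<in>T. std_normal) lborel (\<lambda>\<xi>. \<xi> j) = std_normal" .
    moreover have "(\<lambda>\<xi>. \<xi> j) \<in> borel_measurable (\<Pi>\<^sub>M j\<in>T. std_normal)"
      using measurable_component_singleton[OF that, of "\<lambda>_. std_normal"] by simp
    ultimately show ?thesis by (simp add: distributed_def)
  qed
  have "distributed (\<Pi>\<^sub>M j\<in>T. std_normal) lborel (\<lambda>\<xi>. \<Sum>j\<in>L k. \<xi> j)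
      (normal_density (\<Sum>j\<in>L k. 0) (sqrt (\<Sum>j\<in>L k. 1\<^sup>2)))"
    using ne L[OF k] comp
    by (intro P.sum_indep_normal P.indep_vars_subset[OF ind]) auto
  then have "distributed (\<Pi>\<^sub>M j\<in>T. std_normal) lborel (\<lambda>\<xi>. \<Sum>j\<in>L k. \<xi> j)
      (normal_density 0 (sqrt (real m)))"
    using card[OF k] by simp
  then have "distributed (\<Pi>\<^sub>M j\<in>T. std_normal) lborel (Z m k) std_normal_density"
    using P.normal_standard_normal_convert[of "sqrt (real m)" "\<lambda>\<xi>. \<Sum>j\<in>L k. \<xi> j" 0] m
    by (simp add: Z_def)
  then show "distr (\<Pi>\<^sub>M j\<in>T. std_normal) borel (Z m k) = std_normal"
    by (auto dest!: distributed_distr_eq_density cong: distr_cong)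
qed


section \<open>Exchanges of a row or a column\<close>

text \<open>Exchanging a part \<open>R\<close> of the maximiser for a part \<open>R'\<close> outside it changes the objective by the
  difference of the two partial sums, which therefore cannot be positive.\<close>

lemma argmax_exchange:
  fixes Y :: "'j \<Rightarrow> real"
  assumes max: "is_arg_max (sum Y) (\<lambda>C. C \<in> S) C"
    and C: "finite C" "R \<subseteq> C" and R': "finite R'" "R' \<inter> C = {}"
    and mem: "(C - R) \<union> R' \<in> S"
  shows "sum Y R' \<le> sum Y R"
proof -
  have "sum Y ((C - R) \<union> R') \<le> sum Y C"
    using max mem by (auto simp: is_arg_max_linorder)
  moreover have "sum Y ((C - R) \<union> R') = sum Y (C - R) + sum Y R'"
    using C R' by (intro sum.union_disjoint) auto
  moreover have "sum Y C = sum Y (C - R) + sum Y R"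
    using sum.subset_diff[OF C(2,1)] .
  ultimately show ?thesis by simp
qed

lemma argmax_row_exchange:
  assumes max: "is_arg_max (\<lambda>C. \<Sum>ij\<in>C. Y ij :: real) (\<lambda>C. C \<in> submatrix_sets N M n m) (A \<times> B)"
    and A: "A \<subseteq> {1..N}" "card A = n" and B: "B \<subseteq> {1..M}" "card B = m"
    and i: "i \<in> A" and k: "k \<in> {1..N} - A"
  shows "(\<Sum>ij\<in>{k} \<times> B. Y ij) \<le> (\<Sum>ij\<in>{i} \<times> B. Y ij)"
proof (rule argmax_exchange[OF max])
  have fin: "finite A" "finite B"
    using A(1) B(1) by (auto intro: finite_subset)
  then show "finite (A \<times> B)" "finite ({k} \<times> B)" by auto
  have "card (insert k (A - {i})) = n"
    using fin A(2) i k card_Suc_Diff1[of A i] by simp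
  then have "insert k (A - {i}) \<times> B \<in> submatrix_sets N M n m"
    unfolding submatrix_sets_def using A B k by blast
  also have "insert k (A - {i}) \<times> B = (A \<times> B - {i} \<times> B) \<union> {k} \<times> B"
    by auto
  finally show "(A \<times> B - {i} \<times> B) \<union> {k} \<times> B \<in> submatrix_sets N M n m" .
qed (use i k in auto)

lemma argmax_column_exchange:
  assumes max: "is_arg_max (\<lambda>C. \<Sum>ij\<in>C. Y ij :: real) (\<lambda>C. C \<in> submatrix_sets N M n m) (A \<times> B)"
    and A: "A \<subseteq> {1..N}" "card A = n" and B: "B \<subseteq> {1..M}" "card B = m"
    and i: "i \<in> B" and k: "k \<in> {1..M} - B"
  shows "(\<Sum>ij\<in>A \<times> {k}. Y ij) \<le> (\<Sum>ij\<in>A \<times> {i}. Y ij)"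
proof (rule argmax_exchange[OF max])
  have fin: "finite A" "finite B"
    using A(1) B(1) by (auto intro: finite_subset)
  then show "finite (A \<times> B)" "finite (A \<times> {k})" by auto
  have "card (insert k (B - {i})) = m"
    using fin B(2) i k card_Suc_Diff1[of B i] by simp
  then have "A \<times> insert k (B - {i}) \<in> submatrix_sets N M n m"
    unfolding submatrix_sets_def using A B k by blast
  also have "A \<times> insert k (B - {i}) = (A \<times> B - A \<times> {i}) \<union> A \<times> {k}"
    by auto
  finally show "(A \<times> B - A \<times> {i}) \<union> A \<times> {k} \<in> submatrix_sets N M n m" .
qed (use i k in auto)

section \<open>Recovery under the flat signal\<close>

lemma measurable_add_signal:
  "(\<lambda>\<xi>. \<lambda>ij \<in> index_set N M. s ij + \<xi> ij) \<in> noise_law N M \<rightarrow>\<^sub>M matrix_space N M"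
proof -
  have "(\<lambda>\<xi>. \<xi> ij) \<in> borel_measurable (noise_law N M)" if "ij \<in> index_set N M" for ij
    using measurable_component_singleton[OF that, of "\<lambda>_. std_normal"]
    by (simp add: noise_law_def)
  then show ?thesis by (intro measurable_restrict borel_measurable_add) auto
qed

lemma prob_space_noise_law: "prob_space (noise_law N M)"
  unfolding noise_law_def by (intro prob_space_PiM prob_space_std_normal)

lemma prob_space_obs_law: "prob_space (obs_law N M s)"
  unfolding obs_law_def
  by (intro prob_space.prob_space_distr prob_space_noise_law measurable_add_signal)

lemma error_prob_le_1: "error_prob N M s D C \<le> 1"
  unfolding error_prob_def by (intro prob_space.prob_le_1 prob_space_obs_law)

lemma recovery_prob_eq:
  assumes D: "selector N M n m D" and C: "C \<in> submatrix_sets N M n m"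
  shows "1 - error_prob N M s D C
    = measure (noise_law N M) {\<xi> \<in> space (noise_law N M). D (\<lambda>ij \<in> index_set N M. s ij + \<xi> ij) = C}"
proof -
  interpret O: prob_space "obs_law N M s" by (rule prob_space_obs_law)
  have sp: "space (obs_law N M s) = space (matrix_space N M)"
    and st: "sets (obs_law N M s) = sets (matrix_space N M)"
    by (simp_all add: obs_law_def)
  have "D -` {C} \<inter> space (matrix_space N M) \<in> sets (matrix_space N M)"
    using D C by (intro measurable_sets[where A = "count_space (submatrix_sets N M n m)"])
      (auto simp: selector_def)
  also have "D -` {C} \<inter> space (matrix_space N M) = {Y \<in> space (matrix_space N M). D Y = C}"
    by auto
  finally have ev: "{Y \<in> space (matrix_space N M). D Y = C} \<in> sets (matrix_space N M)" .
  have "1 - error_prob N M s D C = measure (obs_law N M s) {Y \<in> space (matrix_space N M). D Y = C}"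
    using O.prob_neg[of "\<lambda>Y. D Y = C"] ev by (simp add: error_prob_def sp st)
  also have "\<dots> = measure (noise_law N M) {\<xi> \<in> space (noise_law N M). D (\<lambda>ij \<in> index_set N M. s ij + \<xi> ij) = C}"
    unfolding obs_law_def using measurable_add_signal[where N = N and M = M and s = s] ev
    by (subst measure_distr) (auto intro!: arg_cong[where f = "measure (noise_law N M)"] dest: measurable_space)
  finally show ?thesis .
qed

text \<open>The bound on the probability that none of \<open>x\<close> independent standard normal variables exceeds
  \<open>c \<surd>(2 ln x)\<close>; at \<open>c = 1\<close> this threshold is close to the typical value of their maximum.\<close>

definition miss_bound :: "real \<Rightarrow> real \<Rightarrow> real" where
  "miss_bound c x = exp (- (x * std_normal_density (c * sqrt (2 * ln x) + 1)))"

text \<open>The blocks \<open>L i\<close>, \<open>i \<in> I\<close>, stand for the rows (or columns) of \<open>C\<close>, and the \<open>L k\<close>, \<open>k \<in> J\<close>, for the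
  blocks by which they may be replaced. A block inside \<open>C\<close> carries the additional signal \<open>l b\<close>; after
  division by \<open>\<surd>l\<close>, the standard deviation of a block sum, the advantage is \<open>b \<surd>l\<close>. The condition
  on \<open>c\<close> says that this is less than \<open>c\<close> times the gap expected between the extremes of the block
  noise. Its denominator must be positive, hence two blocks at least in \<open>I\<close>.\<close>

lemma recovery_prob_le_blocks:
  fixes L :: "'k \<Rightarrow> (nat \<times> nat) set"
  assumes D: "selector N M n m D" and C: "C \<in> submatrix_sets N M n m"
    and I: "finite I" "\<And>i. i \<in> I \<Longrightarrow> L i \<subseteq> C"
    and J: "finite J" "\<And>k. k \<in> J \<Longrightarrow> L k \<subseteq> index_set N M - C"
    and disj: "disjoint_family_on L (I \<union> J)"
    and card: "\<And>k. k \<in> I \<union> J \<Longrightarrow> card (L k) = l" and l: "0 < l"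
    and exch: "\<And>Y i k. \<lbrakk>Y \<in> space (matrix_space N M); D Y = C; i \<in> I; k \<in> J\<rbrakk>
      \<Longrightarrow> (\<Sum>ij\<in>L k. Y ij) \<le> (\<Sum>ij\<in>L i. Y ij)"
    and c: "0 \<le> c" and size: "2 \<le> card I" "1 \<le> card J"
    and weak: "b * sqrt (real l) / (sqrt 2 * (sqrt (ln (real (card I))) + sqrt (ln (real (card J))))) < c"
  shows "1 - error_prob N M (flat_signal C b) D C
    \<le> miss_bound c (real (card I)) + miss_bound c (real (card J))"
proof -
  let ?s = "flat_signal C b"
  let ?Y = "\<lambda>\<xi>. \<lambda>ij \<in> index_set N M. ?s ij + \<xi> ij"
  let ?Z = "\<lambda>k \<xi>. (\<Sum>j\<in>L k. \<xi> j) / sqrt (real l)"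
  let ?t = "\<lambda>x. c * sqrt (2 * ln x)"
  interpret P: prob_space "noise_law N M" by (rule prob_space_noise_law)
  have CT: "C \<subseteq> index_set N M"
    using C by (auto simp: submatrix_sets_def index_set_def)
  have T: "finite (index_set N M)" by (simp add: index_set_def)
  have LT: "L k \<subseteq> index_set N M" if "k \<in> I \<union> J" for k
    using that I(2) J(2) CT by blast
  note Z = block_sums_std_normal[where L = L and K = "I \<union> J" and T = "index_set N M" and m = l,
      OF T LT disj card l, folded noise_law_def]
  have "0 < sqrt (ln (real (card I)))" "0 \<le> sqrt (ln (real (card J)))"
    using size by auto
  then have "b * sqrt (real l) < c * (sqrt 2 * (sqrt (ln (real (card I))) + sqrt (ln (real (card J)))))"
    using weak by (subst (asm) pos_divide_less_eq) (auto intro!: mult_pos_pos add_pos_nonneg)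
  also have "\<dots> = ?t (real (card I)) + ?t (real (card J))"
    by (simp add: real_sqrt_mult algebra_simps)
  finally have gap: "b * sqrt (real l) \<le> ?t (real (card I)) + ?t (real (card J))" by simp
  have range: "?Z k \<xi> - ?Z i \<xi> \<le> ?t (real (card I)) + ?t (real (card J))"
    if \<xi>: "\<xi> \<in> space (noise_law N M)" "D (?Y \<xi>) = C" and i: "i \<in> I" and k: "k \<in> J" for \<xi> i k
  proof -
    have "(\<Sum>ij\<in>L k. ?Y \<xi> ij) \<le> (\<Sum>ij\<in>L i. ?Y \<xi> ij)"
      by (rule exch[OF measurable_space[OF measurable_add_signal \<xi>(1)] \<xi>(2) i k])
    moreover have "(\<Sum>ij\<in>L k. ?Y \<xi> ij) = (\<Sum>ij\<in>L k. \<xi> ij)"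
      using J(2)[OF k] by (intro sum.cong) (auto simp: flat_signal_def)
    moreover have "(\<Sum>ij\<in>L i. ?Y \<xi> ij) = (\<Sum>ij\<in>L i. b + \<xi> ij)"
      using I(2)[OF i] CT by (intro sum.cong) (auto simp: flat_signal_def)
    ultimately have "(\<Sum>ij\<in>L k. \<xi> ij) - (\<Sum>ij\<in>L i. \<xi> ij) \<le> real l * b"
      using card i by (simp add: sum.distrib)
    then have "?Z k \<xi> - ?Z i \<xi> \<le> real l * b / sqrt (real l)"
      by (simp add: diff_divide_distrib[symmetric] divide_right_mono)
    also have "\<dots> = b * sqrt (real l)"
      by (simp add: real_div_sqrt mult.commute flip: times_divide_eq_right)
    finally show ?thesis using gap by simp
  qed
  show ?thesis
    unfolding recovery_prob_eq[OF D C] miss_bound_def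
    using size c range I(1) J(1)
    by (intro P.prob_range_le[OF Z(1) _ Z(2)]) auto
qed

lemma recovery_prob_le_rows:
  assumes D: "argmax_selector N M n m D" and C: "C \<in> submatrix_sets N M n m"
    and size: "2 \<le> n" "n < N" "0 < m" and c: "0 \<le> c" and weak: "A1 N M n m b < c"
  shows "1 - error_prob N M (flat_signal C b) D C
    \<le> miss_bound c (real n) + miss_bound c (real N - real n)"
proof -
  obtain A B where AB: "C = A \<times> B" "A \<subseteq> {1..N}" "B \<subseteq> {1..M}" "card A = n" "card B = m"
    using C by (auto simp: submatrix_sets_def)
  have fin: "finite A" using AB(2) by (rule finite_subset) simp
  have cJ: "card ({1..N} - A) = N - n"
    using AB fin by (simp add: card_Diff_subset)
  have "1 - error_prob N M (flat_signal C b) D C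
    \<le> miss_bound c (real (card A)) + miss_bound c (real (card ({1..N} - A)))"
  proof (rule recovery_prob_le_blocks[where L = "\<lambda>i. {i} \<times> B" and l = m])
    fix Y i k assume "Y \<in> space (matrix_space N M)" "D Y = C" "i \<in> A" "k \<in> {1..N} - A"
    with D AB show "(\<Sum>ij\<in>{k} \<times> B. Y ij) \<le> (\<Sum>ij\<in>{i} \<times> B. Y ij)"
      by (intro argmax_row_exchange[of Y N M n m A B]) (auto simp: argmax_selector_def)
  qed (use D C AB fin cJ size c weak in
      \<open>auto simp: argmax_selector_def index_set_def disjoint_family_on_def A1_def of_nat_diff
        card_cartesian_product\<close>)
  then show ?thesis using AB cJ size by (simp add: of_nat_diff)
qed

lemma recovery_prob_le_columns:
  assumes D: "argmax_selector N M n m D" and C: "C \<in> submatrix_sets N M n m"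
    and size: "2 \<le> m" "m < M" "0 < n" and c: "0 \<le> c" and weak: "A2 N M n m b < c"
  shows "1 - error_prob N M (flat_signal C b) D C
    \<le> miss_bound c (real m) + miss_bound c (real M - real m)"
proof -
  obtain A B where AB: "C = A \<times> B" "A \<subseteq> {1..N}" "B \<subseteq> {1..M}" "card A = n" "card B = m"
    using C by (auto simp: submatrix_sets_def)
  have fin: "finite B" using AB(3) by (rule finite_subset) simp
  have cJ: "card ({1..M} - B) = M - m"
    using AB fin by (simp add: card_Diff_subset)
  have "1 - error_prob N M (flat_signal C b) D C
    \<le> miss_bound c (real (card B)) + miss_bound c (real (card ({1..M} - B)))"
  proof (rule recovery_prob_le_blocks[where L = "\<lambda>j. A \<times> {j}" and l = n])
    fix Y i k assume "Y \<in> space (matrix_space N M)" "D Y = C" "i \<in> B" "k \<in> {1..M} - B"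
    with D AB show "(\<Sum>ij\<in>A \<times> {k}. Y ij) \<le> (\<Sum>ij\<in>A \<times> {i}. Y ij)"
      by (intro argmax_column_exchange[of Y N M n m A B]) (auto simp: argmax_selector_def)
  qed (use D C AB fin cJ size c weak in
      \<open>auto simp: argmax_selector_def index_set_def disjoint_family_on_def A2_def of_nat_diff
        card_cartesian_product\<close>)
  then show ?thesis using AB cJ size by (simp add: of_nat_diff)
qed

section \<open>Asymptotics\<close>

text \<open>In terms of \<open>w = \<surd>(2 ln x)\<close> one has \<open>x = exp (w\<^sup>2 / 2)\<close>, so the exponent in
  \<open>x \<phi>(c w + 1)\<close> is a quadratic polynomial in \<open>w\<close> with leading coefficient \<open>(1 - c\<^sup>2) / 2 > 0\<close>.\<close>

lemma miss_bound_tendsto_0: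
  assumes c: "0 \<le> c" "c < 1"
  shows "(miss_bound c \<longlongrightarrow> 0) at_top"
proof -
  define k where "k = (1 - c\<^sup>2) / 2"
  have "c\<^sup>2 < 1"
    using c by (simp add: power_less_one_iff)
  then have k: "0 < k" by (simp add: k_def)
  have u: "filterlim (\<lambda>x::real. sqrt (2 * ln x)) at_top at_top"
    by real_asymp
  have q: "filterlim (\<lambda>u::real. exp (k * u\<^sup>2 - c * u - 1 / 2) / sqrt (2 * pi)) at_top at_top"
    using k by real_asymp
  have "filterlim (\<lambda>x::real. x * std_normal_density (c * sqrt (2 * ln x) + 1)) at_top at_top"
  proof (rule filterlim_cong[THEN iffD1, OF refl refl _ filterlim_compose[OF q u]])
    show "\<forall>\<^sub>F x::real in at_top. exp (k * (sqrt (2 * ln x))\<^sup>2 - c * sqrt (2 * ln x) - 1 / 2) / sqrt (2 * pi)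
        = x * std_normal_density (c * sqrt (2 * ln x) + 1)"
      using eventually_ge_at_top[of 1]
    proof eventually_elim
      case (elim x)
      define w where "w = sqrt (2 * ln x)"
      have w: "w\<^sup>2 = 2 * ln x" using elim by (simp add: w_def)
      then have "x = exp (w\<^sup>2 / 2)" using elim by simp
      then have "x * std_normal_density (c * w + 1) = exp (w\<^sup>2 / 2 + - (c * w + 1)\<^sup>2 / 2) / sqrt (2 * pi)"
        by (simp only: std_normal_density_def exp_add) simp
      also have "w\<^sup>2 / 2 + - (c * w + 1)\<^sup>2 / 2 = k * w\<^sup>2 - c * w - 1 / 2"
        by (simp add: k_def power2_eq_square field_simps)
      finally show ?case by (simp add: w_def)
    qed
  qed
  then show ?thesis
    unfolding miss_bound_def[abs_def]
    by (intro filterlim_compose[OF exp_at_bot]) (simp add: filterlim_uminus_at_bot)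
qed

lemma filterlim_diff_at_top_of_ratio:
  fixes n N :: "'x \<Rightarrow> nat"
  assumes n: "filterlim n at_top F" and ratio: "((\<lambda>x. real (n x) / real (N x)) \<longlongrightarrow> 0) F"
    and N: "\<forall>\<^sub>F x in F. 0 < N x"
  shows "filterlim (\<lambda>x. real (N x) - real (n x)) at_top F"
proof (rule filterlim_at_top_mono)
  show "filterlim (\<lambda>x. real (n x)) at_top F"
    by (rule filterlim_compose[OF filterlim_real_sequentially n])
  have "\<forall>\<^sub>F x in F. real (n x) / real (N x) < 1 / 2"
    by (rule order_tendstoD(2)[OF ratio]) simp
  with N show "\<forall>\<^sub>F x in F. real (n x) \<le> real (N x) - real (n x)"
    by eventually_elim (simp add: field_simps)
qed

text \<open>This is the limiting step in a form common to rows and columns: \<open>e\<close> stands for the error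
  probability and \<open>A\<close> for the signal-to-noise ratio in question.\<close>

lemma error_prob_tendsto_1:
  fixes n N :: "'x \<Rightarrow> nat" and e :: "'x \<Rightarrow> real"
  assumes n: "filterlim n at_top F" and ratio: "((\<lambda>x. real (n x) / real (N x)) \<longlongrightarrow> 0) F"
    and N: "\<forall>\<^sub>F x in F. 0 < N x"
    and A: "Limsup F (\<lambda>x. ereal (A x)) < 1"
    and e: "\<And>x. e x \<le> 1"
    and bound: "\<And>c. 0 \<le> c \<Longrightarrow> \<forall>\<^sub>F x in F. 2 \<le> n x \<longrightarrow> n x < N x \<longrightarrow> A x < c
      \<longrightarrow> 1 - e x \<le> miss_bound c (real (n x)) + miss_bound c (real (N x) - real (n x))"
  shows "(e \<longlongrightarrow> 1) F"
proof -
  obtain r where r: "Limsup F (\<lambda>x. ereal (A x)) < ereal r" "ereal r < 1"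
    using ereal_dense2[OF A] by auto
  \<comment> \<open>The level \<open>r\<close> separating the upper limit from 1 may be negative, whereas thresholds must not be.\<close>
  define c where "c = max 0 r"
  have c: "0 \<le> c" "c < 1" "r \<le> c"
    using r(2) by (auto simp: c_def one_ereal_def)
  have "\<forall>\<^sub>F x in F. A x < c"
    using Limsup_lessD[OF r(1)] by eventually_elim (use c in auto)
  moreover have diff: "filterlim (\<lambda>x. real (N x) - real (n x)) at_top F"
    using n ratio N by (rule filterlim_diff_at_top_of_ratio)
  then have "\<forall>\<^sub>F x in F. 0 < real (N x) - real (n x)"
    by (simp only: filterlim_at_top_dense)
  moreover have "\<forall>\<^sub>F x in F. 2 \<le> n x"
    using n by (auto simp: filterlim_at_top)
  ultimately have lower: "\<forall>\<^sub>F x in F.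
      1 - (miss_bound c (real (n x)) + miss_bound c (real (N x) - real (n x))) \<le> e x"
    using bound[OF c(1)] by eventually_elim auto
  have "((\<lambda>x. 1 - (miss_bound c (real (n x)) + miss_bound c (real (N x) - real (n x)))) \<longlongrightarrow> 1 - (0 + 0)) F"
    using filterlim_compose[OF filterlim_real_sequentially n] diff
    by (intro tendsto_diff tendsto_add tendsto_const filterlim_compose[OF miss_bound_tendsto_0[OF c(1,2)]])
  then show ?thesis
    using e by (intro tendsto_sandwich[OF lower _ _ tendsto_const]) auto
qed

theorem proposition2p1:
  fixes n m :: "nat \<Rightarrow> nat \<Rightarrow> nat"
    and a :: "nat \<Rightarrow> nat \<Rightarrow> real"
    and Cstar :: "nat \<Rightarrow> nat \<Rightarrow> estimator"
    and C0 :: "nat \<Rightarrow> nat \<Rightarrow> (nat \<times> nat) set"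
    and F :: "(nat \<times> nat) filter"
  defines "F \<equiv> at_top \<times>\<^sub>F at_top"
  assumes "filterlim (\<lambda>(N, M). n N M) at_top F"
    and "filterlim (\<lambda>(N, M). m N M) at_top F"
    and "((\<lambda>(N, M). real (n N M) / real N) \<longlongrightarrow> 0) F"
    and "((\<lambda>(N, M). real (m N M) / real M) \<longlongrightarrow> 0) F"
    and "\<forall>\<^sub>F (N, M) in F. a N M > 0"
    and "\<forall>\<^sub>F (N, M) in F. argmax_selector N M (n N M) (m N M) (Cstar N M)"
    and "Limsup F (\<lambda>(N, M). ereal (A1 N M (n N M) (m N M) (a N M))) < 1 \<or>
         Limsup F (\<lambda>(N, M). ereal (A2 N M (n N M) (m N M) (a N M))) < 1"
    and "\<forall>\<^sub>F (N, M) in F. C0 N M \<in> submatrix_sets N M (n N M) (m N M)"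
  shows "((\<lambda>(N, M). worst_error_prob N M (a N M) (Cstar N M) (C0 N M)) \<longlongrightarrow> 1) F \<and>
         ((\<lambda>(N, M). error_prob N M (flat_signal (C0 N M) (a N M)) (Cstar N M) (C0 N M)) \<longlongrightarrow> 1) F"
proof -
  let ?e = "\<lambda>x. error_prob (fst x) (snd x) (flat_signal (C0 (fst x) (snd x)) (a (fst x) (snd x)))
    (Cstar (fst x) (snd x)) (C0 (fst x) (snd x))"
  let ?w = "\<lambda>x. worst_error_prob (fst x) (snd x) (a (fst x) (snd x)) (Cstar (fst x) (snd x))
    (C0 (fst x) (snd x))"
  note lim = assms(2-5)[unfolded case_prod_unfold]
  note sel = assms(7)[unfolded case_prod_unfold] and mem = assms(9)[unfolded case_prod_unfold]
  have N: "\<forall>\<^sub>F x in F. 0 < fst x" and M: "\<forall>\<^sub>F x in F. 0 < snd x"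
    unfolding F_def
    by (auto intro: eventually_compose_filterlim[OF eventually_gt_at_top filterlim_fst]
        eventually_compose_filterlim[OF eventually_gt_at_top filterlim_snd])
  have pos: "\<forall>\<^sub>F x in F. 0 < n (fst x) (snd x)" "\<forall>\<^sub>F x in F. 0 < m (fst x) (snd x)"
    by (rule eventually_compose_filterlim[OF eventually_gt_at_top lim(1)],
        rule eventually_compose_filterlim[OF eventually_gt_at_top lim(2)])
  have flat: "(?e \<longlongrightarrow> 1) F"
    using assms(8)[unfolded case_prod_unfold]
  proof
    assume "Limsup F (\<lambda>x. ereal (A1 (fst x) (snd x) (n (fst x) (snd x)) (m (fst x) (snd x)) (a (fst x) (snd x)))) < 1"
    then show ?thesis
    proof (rule error_prob_tendsto_1[OF lim(1) lim(3) N])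
      fix c :: real assume c: "0 \<le> c"
      show "\<forall>\<^sub>F x in F. 2 \<le> n (fst x) (snd x) \<longrightarrow> n (fst x) (snd x) < fst x \<longrightarrow>
          A1 (fst x) (snd x) (n (fst x) (snd x)) (m (fst x) (snd x)) (a (fst x) (snd x)) < c \<longrightarrow>
          1 - ?e x \<le> miss_bound c (real (n (fst x) (snd x)))
            + miss_bound c (real (fst x) - real (n (fst x) (snd x)))"
        using sel mem pos(2) by eventually_elim (auto intro: recovery_prob_le_rows c)
    qed (rule error_prob_le_1)
  next
    assume "Limsup F (\<lambda>x. ereal (A2 (fst x) (snd x) (n (fst x) (snd x)) (m (fst x) (snd x)) (a (fst x) (snd x)))) < 1"
    then show ?thesis
    proof (rule error_prob_tendsto_1[OF lim(2) lim(4) M])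
      fix c :: real assume c: "0 \<le> c"
      show "\<forall>\<^sub>F x in F. 2 \<le> m (fst x) (snd x) \<longrightarrow> m (fst x) (snd x) < snd x \<longrightarrow>
          A2 (fst x) (snd x) (n (fst x) (snd x)) (m (fst x) (snd x)) (a (fst x) (snd x)) < c \<longrightarrow>
          1 - ?e x \<le> miss_bound c (real (m (fst x) (snd x)))
            + miss_bound c (real (snd x) - real (m (fst x) (snd x)))"
        using sel mem pos(1) by eventually_elim (auto intro: recovery_prob_le_columns c)
    qed (rule error_prob_le_1)
  qed
  have bdd: "bdd_above ((\<lambda>s. error_prob N M s D C) ` S)" for N M D C S
    by (rule bdd_aboveI[of _ 1]) (auto simp: error_prob_le_1)
  have flat_in: "flat_signal C b \<in> signals_on N M C b" for N M C b
    by (auto simp: signals_on_def flat_signal_def)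
  have lower: "?e x \<le> ?w x" and upper: "?w x \<le> 1" for x
    unfolding worst_error_prob_def
    using flat_in[of "C0 (fst x) (snd x)" "a (fst x) (snd x)" "fst x" "snd x"]
    by (auto intro!: cSUP_upper cSUP_least bdd error_prob_le_1)
  have "(?w \<longlongrightarrow> 1) F"
    using lower upper by (intro tendsto_sandwich[OF _ _ flat tendsto_const]) auto
  with flat show ?thesis by (simp add: case_prod_unfold)
qed

end
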